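(* Let $n\ge 2$ be an integer and let $a_1>a_2>\cdots>a_n>0$ be real numbers. Put $e_1=1$ and $e_i=\sqrt{a_i/a_1}$ for $i=2,\ldots,n$, and let $$J=\left\{\,j\in\{2,\ldots,n\}:\ e_j>\frac{e_{j-1}+\cdots+e_1}{j}\right\}.$$ The problem of minimizing $$\sum_{i=1}^n\frac{a_i}{1+x_i}$$ over the set $S_n=\{(x_1,\ldots,x_n)\in\mathbb{R}^n: x_1+\cdots+x_n=1,\ x_i\ge 0 \text{ for } i=1,\ldots,n\}$ has a unique optimal solution $(x_1^\star,\ldots,x_n^\star)$, and it is given as follows. (1) If $J=\emptyset$, then $x_1^\star=1$ and $x_2^\star=\cdots=x_n^\star=0$. (2) If $J\ne\emptyset$, let $k=\max J$. Then $k$ is found by testing $j=2,3,\ldots$ sequentially for membership in $J$ and stopping at the first violation (that is, $J=\{2,\ldots,k\}$), and $$x_j^\star=\frac{k\,e_j-\sum_{1\le i\le k,\ i\ne j}e_i}{e_1+e_2+\cdots+e_k}\quad\text{for } j=1,\ldots,k,\qquad x_j^\star=0\quad\text{for } j=k+1,\ldots,n.$$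
   Context: The minimization problem is equivalent to maximizing $F(x_1,\ldots,x_n)=\sum_{i=1}^n \frac{a_i x_i}{1+x_i}$ over the same set $S_n$, since $\frac{a_i x_i}{1+x_i}=a_i-\frac{a_i}{1+x_i}$. The optimal solution means the point of $S_n$ at which the minimum is attained. *)

theory Defs
  imports "HOL-Analysis.Analysis"
begin

(* A point (x_1, ..., x_n) of R^n is a function in extensional {1..n}: its values outside {1..n}
   are fixed by convention, so equality of such functions is equality of the n coordinates. *)
definition feasible_set :: "nat \<Rightarrow> (nat \<Rightarrow> real) set" where
  "feasible_set n =
     {x \<in> extensional {1..n}. (\<Sum>i=1..n. x i) = 1 \<and> (\<forall>i\<in>{1..n}. x i \<ge> 0)}"

definition objective :: "nat \<Rightarrow> (nat \<Rightarrow> real) \<Rightarrow> (nat \<Rightarrow> real) \<Rightarrow> real" where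
  "objective n a x = (\<Sum>i=1..n. a i / (1 + x i))"

definition optimal_solution :: "nat \<Rightarrow> (nat \<Rightarrow> real) \<Rightarrow> (nat \<Rightarrow> real) \<Rightarrow> bool" where
  "optimal_solution n a x \<longleftrightarrow> is_arg_min (objective n a) (\<lambda>y. y \<in> feasible_set n) x"

definition e :: "(nat \<Rightarrow> real) \<Rightarrow> nat \<Rightarrow> real" where
  "e a i = (if i = 1 then 1 else sqrt (a i / a 1))"

definition J :: "nat \<Rightarrow> (nat \<Rightarrow> real) \<Rightarrow> nat set" where
  "J n a = {j \<in> {2..n}. e a j > (\<Sum>i=1..<j. e a i) / real j}"

end

theory Submission
  imports Defs
begin

text \<open>The objective is a sum of strictly convex functions, so a feasible point satisfying
the Karush-Kuhn-Tucker conditions is strictly better than every other one (lemma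
\<open>sum_recip_less_of_kkt\<close>). Exhibiting such a point gives existence and uniqueness at
once. At a point with support \<open>{1..k}\<close> those conditions say that
\<open>a i / (1 + x i)\<^sup>2\<close> has a common value \<open>a 1 / c\<^sup>2\<close> on the support, that is
\<open>1 + x i = c * e i\<close>; the constraint that the coordinates add up to \<open>1\<close>
then forces \<open>c = (k + 1) / (e 1 + ... + e k)\<close>.

What is left is to choose \<open>k\<close>. Nonnegativity of \<open>x\<close> on the support amounts to
\<open>c * e k \<ge> 1\<close>, and the condition on the multipliers outside it to \<open>c * e (k + 1) \<le> 1\<close>. After
clearing denominators these follow from \<open>k \<in> J\<close> and \<open>k + 1 \<notin> J\<close>, respectively. As \<open>e\<close>
decreases, \<open>J\<close> is an initial segment \<open>{2..k}\<close> (lemma \<open>J_segment\<close>), and its last element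
meets both conditions. The case \<open>J = {}\<close> is the case \<open>k = 1\<close> of the same formula: there
\<open>c = 2\<close> and \<open>e 1 = 1\<close>, so the first condition holds by itself.\<close>

section \<open>Optimality from the Karush-Kuhn-Tucker conditions\<close>

text \<open>With \<open>u = 1 + y\<close> and \<open>v = 1 + x\<close>, the function \<open>1 / u\<close> exceeds its tangent at \<open>v\<close> by
\<open>(u - v)\<^sup>2 / (u * v\<^sup>2)\<close>. Weighted by \<open>a i\<close>, the tangent terms add up to something nonnegative,
because replacing every \<open>a i / (1 + x i)\<^sup>2\<close> by the multiplier \<open>\<mu>\<close> can only lower them: the two
differ only where \<open>x i = 0 \<le> y i\<close>. With the constant \<open>\<mu>\<close> they add up to zero.\<close>

lemma sum_recip_less_of_kkt:
  fixes a x y :: "'i \<Rightarrow> real"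
  assumes "finite I"
    and pos: "\<And>i. i \<in> I \<Longrightarrow> a i > 0"
    and x: "\<And>i. i \<in> I \<Longrightarrow> x i \<ge> 0" and y: "\<And>i. i \<in> I \<Longrightarrow> y i \<ge> 0"
    and sums: "sum x I = sum y I"
    and slope_le: "\<And>i. i \<in> I \<Longrightarrow> a i / (1 + x i)\<^sup>2 \<le> \<mu>"
    and slope_eq: "\<And>i. i \<in> I \<Longrightarrow> x i \<noteq> 0 \<Longrightarrow> a i / (1 + x i)\<^sup>2 = \<mu>"
    and j: "j \<in> I" "x j \<noteq> y j"
  shows "(\<Sum>i\<in>I. a i / (1 + x i)) < (\<Sum>i\<in>I. a i / (1 + y i))"
proof -
  have tangent: "a i / (1 + y i) = a i / (1 + x i) + a i / (1 + x i)\<^sup>2 * (x i - y i)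
      + a i * (x i - y i)\<^sup>2 / ((1 + y i) * (1 + x i)\<^sup>2)" if "i \<in> I" for i
  proof -
    define u v where "u = 1 + y i" and "v = 1 + x i"
    have "u \<noteq> 0" "v \<noteq> 0"
      using x[OF that] y[OF that] by (auto simp: u_def v_def)
    then have "a i / v + a i / v\<^sup>2 * (v - u) + a i * (v - u)\<^sup>2 / (u * v\<^sup>2)
        = (a i * u * v + a i * u * (v - u) + a i * (v - u)\<^sup>2) / (u * v\<^sup>2)"
      by (simp add: add_divide_distrib power2_eq_square)
    also have "a i * u * v + a i * u * (v - u) + a i * (v - u)\<^sup>2 = a i * v\<^sup>2"
      by algebra
    finally show ?thesis
      using \<open>v \<noteq> 0\<close> by (simp add: u_def v_def)
  qed
  have slope: "\<mu> * (x i - y i) \<le> a i / (1 + x i)\<^sup>2 * (x i - y i)" if "i \<in> I" for i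
  proof (cases "x i = 0")
    case True
    then show ?thesis
      using mult_right_mono[OF slope_le[OF that] y[OF that]] by simp
  next
    case False
    then show ?thesis
      using slope_eq[OF that] by simp
  qed
  have le: "a i / (1 + x i) + \<mu> * (x i - y i) \<le> a i / (1 + y i)" if "i \<in> I" for i
  proof -
    have "0 \<le> a i * (x i - y i)\<^sup>2 / ((1 + y i) * (1 + x i)\<^sup>2)"
      using pos[OF that] y[OF that] by simp
    then show ?thesis
      using tangent[OF that] slope[OF that] by linarith
  qed
  have less: "a j / (1 + x j) + \<mu> * (x j - y j) < a j / (1 + y j)"
  proof -
    have "0 < a j * (x j - y j)\<^sup>2 / ((1 + y j) * (1 + x j)\<^sup>2)"
      using pos[OF j(1)] y[OF j(1)] x[OF j(1)] j(2) by (intro divide_pos_pos mult_pos_pos) auto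
    then show ?thesis
      using tangent[OF j(1)] slope[OF j(1)] by linarith
  qed
  have "(\<Sum>i\<in>I. a i / (1 + x i)) = (\<Sum>i\<in>I. a i / (1 + x i) + \<mu> * (x i - y i))"
    using sums by (simp add: sum.distrib sum_subtractf flip: sum_distrib_left)
  also have "\<dots> < (\<Sum>i\<in>I. a i / (1 + y i))"
    using le less j(1) by (intro sum_strict_mono_ex1 \<open>finite I\<close>) auto
  finally show ?thesis .
qed

section \<open>The index set J\<close>

text \<open>With \<open>e j\<close> moved into the sum, the test for \<open>j = k\<close> is the inequality \<open>c * e k > 1\<close>.
For \<open>j = k + 1\<close> it is the original form that reads \<open>c * e (k + 1) > 1\<close>.\<close>

lemma mem_J_iff:
  "j \<in> J n a \<longleftrightarrow> j \<in> {2..n} \<and> (\<Sum>i=1..j. e a i) < (real j + 1) * e a j"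
proof (cases "j \<ge> 2")
  case True
  then have "(\<Sum>i=1..j. e a i) = (\<Sum>i=1..<j. e a i) + e a j"
    by (simp add: sum.last_plus add.commute)
  then show ?thesis
    using True by (auto simp: J_def field_simps)
qed (simp add: J_def)

text \<open>If \<open>j + 1\<close> passes the test, then \<open>(j + 1) * e (j + 1)\<close> exceeds \<open>e 1 + ... + e j\<close>; replacing
\<open>e (j + 1)\<close> by the larger \<open>e j\<close> turns this into the test for \<open>j\<close>.\<close>

lemma J_pred:
  assumes "Suc j \<in> J n a" "2 \<le> j" "e a (Suc j) \<le> e a j"
  shows "j \<in> J n a"
proof -
  have "(\<Sum>i=1..j. e a i) < (real j + 1) * e a (Suc j)"
    using assms(1,2) by (auto simp: mem_J_iff algebra_simps)
  also have "\<dots> \<le> (real j + 1) * e a j"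
    using assms(3) by (intro mult_left_mono) auto
  finally show ?thesis
    using assms(1,2) by (auto simp: mem_J_iff)
qed

lemma J_segment:
  assumes decr: "\<And>j. 1 \<le> j \<Longrightarrow> j < n \<Longrightarrow> e a (Suc j) \<le> e a j" and "J n a \<noteq> {}"
  shows "J n a = {2..Max (J n a)}"
proof -
  have fin: "finite (J n a)"
    by (simp add: J_def)
  have sub: "J n a \<subseteq> {2..n}"
    by (auto simp: J_def)
  have max: "Max (J n a) \<in> J n a"
    using fin assms(2) by (rule Max_in)
  have "j \<in> J n a" if "2 \<le> j" "j \<le> Max (J n a)" for j
    using that(2,1)
  proof (induction rule: inc_induct)
    case base
    show ?case by (rule max)
  next
    case (step m)
    then have "m < n"
      using max sub by auto
    then have "e a (Suc m) \<le> e a m"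
      using step.prems by (intro decr) auto
    then show ?case
      using step.IH step.prems by (auto intro: J_pred[of m])
  qed
  then show ?thesis
    using fin sub by auto
qed

section \<open>The minimiser\<close>

lemma decreasing_le:
  fixes a :: "nat \<Rightarrow> real"
  assumes "\<And>i. 1 \<le> i \<Longrightarrow> i < n \<Longrightarrow> a i > a (i + 1)" and "1 \<le> i" "i \<le> j" "j \<le> n"
  shows "a j \<le> a i"
  using assms(3,4)
proof (induction j rule: dec_induct)
  case (step m)
  then show ?case
    using assms(1)[of m] assms(2) by auto
qed simp

theorem mainTheorem1:
  fixes n :: nat and a :: "nat \<Rightarrow> real"
  assumes "n \<ge> 2"
    and "\<And>i. 1 \<le> i \<Longrightarrow> i < n \<Longrightarrow> a i > a (i + 1)"
    and "a n > 0"
  shows "(\<exists>!x. optimal_solution n a x) \<and>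
    (J n a = {} \<longrightarrow>
      (\<forall>x. optimal_solution n a x \<longrightarrow> x 1 = 1 \<and> (\<forall>j\<in>{2..n}. x j = 0))) \<and>
    (J n a \<noteq> {} \<longrightarrow>
      (let k = Max (J n a) in
        J n a = {2..k} \<and>
        (\<forall>x. optimal_solution n a x \<longrightarrow>
          (\<forall>j\<in>{1..k}. x j =
            (real k * e a j - (\<Sum>i\<in>{1..k} - {j}. e a i)) / (\<Sum>i=1..k. e a i)) \<and>
          (\<forall>j\<in>{k+1..n}. x j = 0))))"
proof -
  have a_anti: "a j \<le> a i" if "1 \<le> i" "i \<le> j" "j \<le> n" for i j
    using decreasing_le[of n a, OF assms(2)] that by blast
  have a_pos: "a i > 0" if "i \<in> {1..n}" for i
    using a_anti[of i n] that assms(3) by auto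
  have a1: "a 1 > 0"
    using a_pos assms(1) by simp
  have e_sqrt: "e a i = sqrt (a i / a 1)" for i
    using a1 by (simp add: e_def)
  have e_pos: "e a i > 0" if "i \<in> {1..n}" for i
    using a_pos[OF that] a1 by (simp add: e_sqrt)
  have e_anti: "e a j \<le> e a i" if "1 \<le> i" "i \<le> j" "j \<le> n" for i j
    using a_anti[OF that] a1 by (simp add: e_sqrt divide_right_mono)
  have a_e: "a i = a 1 * (e a i)\<^sup>2" if "i \<in> {1..n}" for i
    using a_pos[OF that] a1 by (simp add: e_sqrt)

  define k where "k = (if J n a = {} then 1 else Max (J n a))"
  have J_k: "J n a = {2..k}"
    using J_segment[of n a] e_anti by (auto simp: k_def)
  have "k \<in> {1..n}"
  proof (cases "J n a = {}")
    case True
    then show ?thesis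
      using assms(1) by (simp add: k_def)
  next
    case False
    then have "k \<in> J n a"
      unfolding k_def using Max_in[of "J n a"] by (simp add: J_def)
    then show ?thesis
      by (simp add: J_def)
  qed
  then have k: "1 \<le> k" "k \<le> n"
    by auto

  define E where "E = (\<Sum>i=1..k. e a i)"
  have E_pos: "E > 0"
    unfolding E_def using k e_pos by (intro sum_pos) auto
  define c where "c = (real k + 1) / E"
  have c_pos: "c > 0"
    using E_pos by (simp add: c_def)
  have c_k: "c * e a k \<ge> 1"
  proof (cases "k = 1")
    case True
    then show ?thesis
      by (simp add: c_def E_def e_def)
  next
    case False
    then have "k \<in> J n a"
      using k J_k by auto
    then show ?thesis
      using E_pos by (simp add: mem_J_iff c_def E_def field_simps)
  qed
  have c_Suc: "c * e a (Suc k) \<le> 1" if "k < n"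
  proof -
    have "Suc k \<notin> J n a"
      using J_k by auto
    then have "(real k + 1) * e a (Suc k) \<le> E"
      using k that by (auto simp: mem_J_iff E_def algebra_simps)
    then show ?thesis
      using E_pos by (simp add: c_def field_simps)
  qed

  define x where "x = (\<lambda>i\<in>{1..n}. if i \<le> k then c * e a i - 1 else 0)"
  have x_on: "x i = c * e a i - 1" if "i \<in> {1..k}" for i
    using that k by (auto simp: x_def)
  have x_off: "x i = 0" if "i \<in> {k+1..n}" for i
    using that by (auto simp: x_def)
  have x_nonneg: "x i \<ge> 0" if "i \<in> {1..n}" for i
  proof (cases "i \<le> k")
    case True
    have "c * e a k \<le> c * e a i"
      using e_anti[of i k] that True k c_pos by simp
    then show ?thesis
      using x_on[of i] True that c_k by auto
  next
    case False
    then show ?thesis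
      using x_off[of i] that by auto
  qed
  have x_sum: "(\<Sum>i=1..n. x i) = 1"
  proof -
    have "(\<Sum>i=1..n. x i) = (\<Sum>i=1..k. x i)"
      using k x_off by (intro sum.mono_neutral_right) auto
    also have "\<dots> = (\<Sum>i=1..k. c * e a i - 1)"
      using x_on by (intro sum.cong) auto
    also have "\<dots> = c * E - real k"
      by (simp add: sum_subtractf E_def flip: sum_distrib_left)
    also have "\<dots> = 1"
      using E_pos by (simp add: c_def)
    finally show ?thesis .
  qed
  have x_feasible: "x \<in> feasible_set n"
    using x_sum x_nonneg by (auto simp: feasible_set_def x_def)

  have slope_on: "a i / (1 + x i)\<^sup>2 = a 1 / c\<^sup>2" if "i \<in> {1..k}" for i
  proof -
    have "i \<in> {1..n}"
      using that k by auto
    then show ?thesis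
      using x_on[OF that] a_e[of i] e_pos[of i] c_pos by (simp add: field_simps)
  qed
  have slope_off: "a i / (1 + x i)\<^sup>2 \<le> a 1 / c\<^sup>2" if "i \<in> {k+1..n}" for i
  proof -
    have i: "i \<in> {1..n}"
      using that by auto
    have "c * e a i \<le> c * e a (Suc k)"
      using e_anti[of "Suc k" i] that c_pos by simp
    also have "\<dots> \<le> 1"
      using c_Suc that by auto
    finally have "(c * e a i)\<^sup>2 \<le> 1"
      using c_pos e_pos[OF i] by (intro power_le_one) auto
    then have "a 1 * (c * e a i)\<^sup>2 \<le> a 1"
      using a1 by simp
    then show ?thesis
      using x_off[OF that] a_e[OF i] c_pos by (simp add: field_simps)
  qed
  have strict: "objective n a x < objective n a y" if y: "y \<in> feasible_set n" "y \<noteq> x" for y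
  proof -
    have "y = x" if "\<forall>j\<in>{1..n}. x j = y j"
      using y(1) x_feasible that
      by (intro extensionalityI[of y "{1..n}" x]) (simp_all add: feasible_set_def)
    then obtain j where j: "j \<in> {1..n}" "x j \<noteq> y j"
      using y(2) by blast
    show ?thesis
      unfolding objective_def
    proof (rule sum_recip_less_of_kkt[where \<mu> = "a 1 / c\<^sup>2" and j = j])
      show "sum x {1..n} = sum y {1..n}"
        using y x_sum by (simp add: feasible_set_def)
      show "a i / (1 + x i)\<^sup>2 \<le> a 1 / c\<^sup>2" if "i \<in> {1..n}" for i
        using slope_on[of i] slope_off[of i] that by (cases "i \<le> k") auto
      show "a i / (1 + x i)\<^sup>2 = a 1 / c\<^sup>2" if "i \<in> {1..n}" "x i \<noteq> 0" for i
        using slope_on[of i] x_off[of i] that by (cases "i \<le> k") auto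
    qed (use j y x_nonneg a_pos in \<open>auto simp: feasible_set_def\<close>)
  qed
  have optimal_iff: "optimal_solution n a y \<longleftrightarrow> y = x" for y
  proof
    assume "optimal_solution n a y"
    then show "y = x"
      using strict[of y] x_feasible by (auto simp: optimal_solution_def is_arg_min_def)
  next
    assume "y = x"
    moreover have "\<not> objective n a z < objective n a x" if "z \<in> feasible_set n" for z
      using strict[OF that] by (cases "z = x") auto
    ultimately show "optimal_solution n a y"
      using x_feasible by (simp add: optimal_solution_def is_arg_min_def)
  qed

  have x_formula: "x j = (real k * e a j - (\<Sum>i\<in>{1..k} - {j}. e a i)) / E"
    if "j \<in> {1..k}" for j
  proof -
    have "(\<Sum>i\<in>{1..k} - {j}. e a i) = E - e a j"
      using that by (simp add: E_def sum_diff1)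
    then show ?thesis
      using x_on[OF that] E_pos by (simp add: c_def field_simps)
  qed
  show ?thesis
  proof (intro conjI impI)
    show "\<exists>!x. optimal_solution n a x"
      by (simp add: optimal_iff)
  next
    assume "J n a = {}"
    then have "k = 1"
      by (simp add: k_def)
    then show "\<forall>x. optimal_solution n a x \<longrightarrow> x 1 = 1 \<and> (\<forall>j\<in>{2..n}. x j = 0)"
      using x_formula[of 1] x_off by (auto simp: optimal_iff E_def e_def)
  next
    assume "J n a \<noteq> {}"
    then have "Max (J n a) = k"
      by (simp add: k_def)
    then show "let k = Max (J n a) in
        J n a = {2..k} \<and>
        (\<forall>x. optimal_solution n a x \<longrightarrow>
          (\<forall>j\<in>{1..k}. x j =
            (real k * e a j - (\<Sum>i\<in>{1..k} - {j}. e a i)) / (\<Sum>i=1..k. e a i)) \<and>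
          (\<forall>j\<in>{k+1..n}. x j = 0))"
      using J_k x_formula x_off by (simp add: optimal_iff E_def Let_def)
  qed
qed

end
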